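(* Let $G$ be a simple connected graph with vertex set $\{1,\dots,m\}$, $m=d+1$, and let $\sigma\in\operatorname{Aut}(G)$. Then $\omega\in\nabla_{A_G,\mathbf 1}\subset\mathbb{C}^{d+1}$ if and only if $\sigma(\omega)\in\nabla_{A_G,\mathbf 1}$, where $\sigma$ acts on $\omega$ by permuting coordinates, $\sigma(\omega)_k = \omega_{\sigma(k)}$.
   Context: $\operatorname{Aut}(G)$ is the group of permutations of the vertices of $G$ preserving adjacency. Let $n$ be the number of edges of $G$. The incidence matrix $A_G\in\mathbb{Z}^{m\times n}$ (with respect to an arbitrary fixed orientation and ordering of the edges) has $l$-th column $a_l = e_k-e_j$ if the $l$-th edge is oriented $k\to j$, where $e_1,\dots,e_m$ are the standard basis vectors of $\mathbb{R}^m$; it has rank $d=m-1$. For $v\in(\mathbb{C}^* )^{d+1}$ put $v^{a_l}=v_kv_j^{-1}$ if $a_l=e_k-e_j$, let $\mathbf 1$ be the all-ones vector (corresponding to scaling $\beta_l=-i$ for all $l$), and $$\psi_{A_G,\mathbf 1}(v) = \Big(\tfrac{1}{2i}(v^{a_1}-v^{-a_1}),\dots,\tfrac{1}{2i}(v^{a_n}-v^{-a_n})\Big)\in\mathbb{C}^n,$$ $$J_{A_G,\mathbf 1}(v) = \tfrac12\,A_G\,\operatorname{diag}\big(-i(v^{a_1}+v^{-a_1}),\dots,-i(v^{a_n}+v^{-a_n})\big)\,A_G^t .$$ The Lissajous discriminant $\nabla_{A_G,\mathbf 1}\subset\mathbb{C}^{d+1}$ is the Zariski closure of the set of all $\omega\in\mathbb{C}^{d+1}$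 for which there is $v\in(\mathbb{C}^* )^{d+1}$ with $$A_G\,\psi_{A_G,\mathbf 1}(v)=\omega,\qquad v_{d+1}=1,\qquad \operatorname{rank}(J_{A_G,\mathbf 1}(v))<d .$$ It is contained in the hyperplane $\omega_1+\cdots+\omega_{d+1}=0$. *)

theory Defs
  imports
    "Jordan_Normal_Form.DL_Rank"
    "Graph_Theory.Graph_Theory"
    "HOL-Library.Poly_Mapping"
    "HOL-Combinatorics.Permutations"
    Complex_Main
begin

text \<open>
  Indices are shifted by one to match the 0-based vectors and matrices: the vertex set
  \<open>{1,\<dots>,m}\<close> becomes \<open>{0..<m}\<close>, and with \<open>m = d+1\<close> the last coordinate of \<open>v\<close> is \<open>v $ d\<close>.
\<close>

section \<open>Zariski closure in affine complex space\<close>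

text \<open>
  Polynomials are finitely supported maps from monomials (finitely supported exponent
  functions on the variables \<open>0, 1, 2, \<dots>\<close>) to coefficients; those in \<open>polys n\<close> use only the
  variables \<open>0, \<dots>, n-1\<close>.
\<close>

type_synonym cpoly = "(nat \<Rightarrow>\<^sub>0 nat) \<Rightarrow>\<^sub>0 complex"

definition polys :: "nat \<Rightarrow> cpoly set" where
  "polys n = {p. \<forall>\<alpha> \<in> Poly_Mapping.keys p. Poly_Mapping.keys \<alpha> \<subseteq> {0..<n}}"

definition eval_poly_at :: "cpoly \<Rightarrow> complex vec \<Rightarrow> complex" where
  "eval_poly_at p x =
     (\<Sum>\<alpha> \<in> Poly_Mapping.keys p. Poly_Mapping.lookup p \<alpha> *
        (\<Prod>i \<in> Poly_Mapping.keys \<alpha>. (x $ i) ^ Poly_Mapping.lookup \<alpha> i))"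

definition zero_locus :: "nat \<Rightarrow> cpoly set \<Rightarrow> complex vec set" where
  "zero_locus n P = {x \<in> carrier_vec n. \<forall>p \<in> P. eval_poly_at p x = 0}"

definition zariski_closed :: "nat \<Rightarrow> complex vec set \<Rightarrow> bool" where
  "zariski_closed n Z \<longleftrightarrow> (\<exists>P \<subseteq> polys n. Z = zero_locus n P)"

definition zariski_closure :: "nat \<Rightarrow> complex vec set \<Rightarrow> complex vec set" where
  "zariski_closure n S = zariski_closed n hull S"

section \<open>The Lissajous discriminant with all scalings equal to one\<close>

definition complex_torus :: "nat \<Rightarrow> complex vec set" where
  "complex_torus n = {v \<in> carrier_vec n. \<forall>i<n. v $ i \<noteq> 0}"

text \<open>The Laurent monomial \<open>v\<^sup>a\<close>; \<open>laurent_mon_edge\<close> below gives its value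
  \<open>v\<^sub>k v\<^sub>j\<^sup>-\<^sup>1\<close> for \<open>a = e\<^sub>k - e\<^sub>j\<close>.\<close>

definition laurent_mon :: "complex vec \<Rightarrow> int vec \<Rightarrow> complex" where
  "laurent_mon v a = (\<Prod>i = 0..<dim_vec a. (v $ i) powi (a $ i))"

definition psi :: "int mat \<Rightarrow> complex vec \<Rightarrow> complex vec" where
  "psi A v = vec (dim_col A)
     (\<lambda>l. 1 / (2 * \<i>) * (laurent_mon v (col A l) - laurent_mon v (- col A l)))"

definition jac :: "int mat \<Rightarrow> complex vec \<Rightarrow> complex mat" where
  "jac A v = (1 / 2) \<cdot>\<^sub>m
     (map_mat of_int A *
      mat_diag (dim_col A)
        (\<lambda>l. - \<i> * (laurent_mon v (col A l) + laurent_mon v (- col A l))) *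
      transpose_mat (map_mat of_int A))"

definition lissajous_discriminant :: "nat \<Rightarrow> int mat \<Rightarrow> complex vec set" where
  "lissajous_discriminant d A = zariski_closure (d + 1)
     {\<omega> \<in> carrier_vec (d + 1). \<exists>v \<in> complex_torus (d + 1).
        map_mat of_int A *\<^sub>v psi A v = \<omega> \<and> v $ d = 1 \<and>
        vec_space.rank (d + 1) (jac A v) < d}"

section \<open>Graphs\<close>

text \<open>
  A finite simple graph is a \<open>pair_graph\<close>, i.e. a symmetric loopfree finite set of pairs:
  each undirected edge \<open>{u,v}\<close> is the pair of arcs \<open>(u,v)\<close>, \<open>(v,u)\<close>. An ordered orientation lists exactly one of the two arcs
  for each edge.
\<close>

definition ordered_orientation :: "'a pair_pre_digraph \<Rightarrow> ('a \<times> 'a) list \<Rightarrow> bool" where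
  "ordered_orientation G es \<longleftrightarrow>
     distinct es \<and> set es \<union> (set es)\<inverse> = parcs G \<and> set es \<inter> (set es)\<inverse> = {}"

definition incidence_matrix :: "nat \<Rightarrow> (nat \<times> nat) list \<Rightarrow> int mat" where
  "incidence_matrix m es = mat_of_cols m (map (\<lambda>(k, j). unit_vec m k - unit_vec m j) es)"

definition graph_aut :: "'a pair_pre_digraph \<Rightarrow> ('a \<Rightarrow> 'a) set" where
  "graph_aut G = {\<sigma>. \<sigma> permutes pverts G \<and>
     (\<forall>u \<in> pverts G. \<forall>v \<in> pverts G. (\<sigma> u, \<sigma> v) \<in> parcs G \<longleftrightarrow> (u, v) \<in> parcs G)}"

definition permute_coords :: "(nat \<Rightarrow> nat) \<Rightarrow> 'a vec \<Rightarrow> 'a vec" where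
  "permute_coords \<sigma> \<omega> = vec (dim_vec \<omega>) (\<lambda>k. \<omega> $ \<sigma> k)"

lemma laurent_mon_edge:
  assumes "k < m" "j < m" "k \<noteq> j"
  shows "laurent_mon v (unit_vec m k - unit_vec m j) = v $ k * inverse (v $ j)"
proof -
  have "laurent_mon v (unit_vec m k - unit_vec m j) =
      (\<Prod>i \<in> {0..<m}. (if i = k then v $ k else 1) * (if i = j then inverse (v $ j) else 1))"
    unfolding laurent_mon_def using assms
    by (intro prod.cong) (auto simp: unit_vec_def power_int_minus)
  also have "\<dots> = v $ k * inverse (v $ j)"
    using assms by (simp add: prod.distrib prod.delta)
  finally show ?thesis .
qed

end

theory Submission
  imports Defs
begin

text \<open>
  If \<open>v\<close> witnesses membership of \<open>\<omega>\<close> in the set whose Zariski closure is the discriminant, then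
  \<open>\<sigma>(v)\<close>, rescaled so that its last coordinate is 1, witnesses membership of \<open>\<sigma>(\<omega>)\<close>: the
  Laurent monomials depend only on ratios of coordinates of \<open>v\<close>, the vector \<open>A \<psi>(v)\<close> and the
  matrix \<open>J(v)\<close> are sums over the arcs of the graph that do not see the chosen orientation, and
  \<open>\<sigma>\<close> permutes these arcs. So \<open>J\<close> merely has its rows and columns permuted.
  A permutation of coordinates is moreover a homeomorphism for the Zariski topology.
\<close>

section \<open>Coordinate permutations\<close>

lemma dim_permute_coords [simp]: "dim_vec (permute_coords \<sigma> x) = dim_vec x"
  by (simp add: permute_coords_def)

lemma permute_coords_carrier [simp]:
  "permute_coords \<sigma> x \<in> carrier_vec n \<longleftrightarrow> x \<in> carrier_vec n"
  by (metis carrier_vecD carrier_vecI dim_permute_coords)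

lemma permute_coords_inv:
  assumes \<sigma>: "\<sigma> permutes {0..<n}" and x: "x \<in> carrier_vec n"
  shows "permute_coords (Hilbert_Choice.inv \<sigma>) (permute_coords \<sigma> x) = x"
proof (rule eq_vecI)
  fix i assume i: "i < dim_vec x"
  then have "Hilbert_Choice.inv \<sigma> i < dim_vec x"
    using permutes_in_image[OF permutes_inv[OF \<sigma>], of i] x by simp
  with i show "permute_coords (Hilbert_Choice.inv \<sigma>) (permute_coords \<sigma> x) $ i = x $ i"
    by (simp add: permute_coords_def permutes_inverses(1)[OF \<sigma>])
qed simp

section \<open>Zariski closures under coordinate permutations\<close>

text \<open>Renaming each variable \<open>i\<close> of \<open>p\<close> to \<open>\<sigma> i\<close>
  is the pullback of polynomials along the coordinate permutation. Since \<open>map_key\<close>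
  precomposes, the coefficient of \<open>\<beta>\<close> in \<open>q\<close> is that of
  \<open>\<beta> \<circ> \<sigma>\<close> in \<open>p\<close>, and the monomial
  \<open>\<beta>\<close> at \<open>x\<close> equals the monomial
  \<open>\<beta> \<circ> \<sigma>\<close> at the permuted point.\<close>

lemma eval_poly_at_permute_coords:
  assumes \<sigma>: "\<sigma> permutes {0..<n}" and p: "p \<in> polys n" and x: "x \<in> carrier_vec n"
  defines "q \<equiv> Poly_Mapping.map_key (Poly_Mapping.map_key \<sigma>) p"
  shows "q \<in> polys n" and "eval_poly_at q x = eval_poly_at p (permute_coords \<sigma> x)"
proof -
  let ?f = "Poly_Mapping.map_key \<sigma> :: (nat \<Rightarrow>\<^sub>0 nat) \<Rightarrow> _"
  let ?g = "Poly_Mapping.map_key (Hilbert_Choice.inv \<sigma>) :: (nat \<Rightarrow>\<^sub>0 nat) \<Rightarrow> _"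
  have inj: "inj \<sigma>" "inj (Hilbert_Choice.inv \<sigma>)"
    using \<sigma> by (auto intro: permutes_inj permutes_inv)
  have gf: "?g (?f \<beta>) = \<beta>" and fg: "?f (?g \<beta>) = \<beta>" for \<beta>
    by (rule poly_mapping_eqI, simp add: map_key.rep_eq inj permutes_inverses[OF \<sigma>])+
  \<comment> \<open>The rules for \<open>map_key\<close> require an injective key map. The outer
    \<open>map_key\<close> acts on exponent functions, so its key map is \<open>?f\<close> and not
    \<sigma>.\<close>
  have injf: "inj ?f"
    by (metis gf injI)
  have keys_f: "Poly_Mapping.keys \<beta> = \<sigma> ` Poly_Mapping.keys (?f \<beta>)" for \<beta>
    using permutes_surj[OF \<sigma>] by (simp add: keys_map_key inj)
  have keys_q: "Poly_Mapping.keys q = ?f -` Poly_Mapping.keys p"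
    by (simp add: q_def keys_map_key injf)
  have sub: "Poly_Mapping.keys (?f \<beta>) \<subseteq> {0..<n}" if "\<beta> \<in> Poly_Mapping.keys q" for \<beta>
    using that p by (auto simp: keys_q polys_def)
  show "q \<in> polys n"
    unfolding polys_def
  proof (intro CollectI ballI)
    fix \<beta> assume "\<beta> \<in> Poly_Mapping.keys q"
    from image_mono[OF sub[OF this], of \<sigma>] show "Poly_Mapping.keys \<beta> \<subseteq> {0..<n}"
      using keys_f permutes_image[OF \<sigma>] by metis
  qed
  have mon: "(\<Prod>i\<in>Poly_Mapping.keys \<beta>. (x $ i) ^ Poly_Mapping.lookup \<beta> i) =
      (\<Prod>i\<in>Poly_Mapping.keys (?f \<beta>). (permute_coords \<sigma> x $ i) ^ Poly_Mapping.lookup (?f \<beta>) i)" if "\<beta> \<in> Poly_Mapping.keys q" for \<beta>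
  proof -
    have "(\<Prod>i\<in>Poly_Mapping.keys \<beta>. (x $ i) ^ Poly_Mapping.lookup \<beta> i) =
        (\<Prod>i\<in>Poly_Mapping.keys (?f \<beta>). (x $ \<sigma> i) ^ Poly_Mapping.lookup \<beta> (\<sigma> i))"
      by (subst keys_f, subst prod.reindex) (auto intro: inj_on_subset[OF inj(1)])
    also have "\<dots> = (\<Prod>i\<in>Poly_Mapping.keys (?f \<beta>). (permute_coords \<sigma> x $ i) ^ Poly_Mapping.lookup (?f \<beta>) i)"
      using sub[OF that] x
      by (intro prod.cong) (auto simp: permute_coords_def map_key.rep_eq inj subset_iff)
    finally show ?thesis .
  qed
  have "bij_betw ?f (Poly_Mapping.keys q) (Poly_Mapping.keys p)"
    unfolding keys_q by (rule bij_betw_byWitness[where f' = ?g]) (auto simp: gf fg)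
  then show "eval_poly_at q x = eval_poly_at p (permute_coords \<sigma> x)"
    unfolding eval_poly_at_def
    by (subst sum.reindex_bij_betw[symmetric], assumption)
       (rule sum.cong, auto simp: mon q_def map_key.rep_eq injf)
qed

text \<open>Continuity: the preimage of a zero locus is cut out by the pulled-back
  equations.\<close>

lemma zariski_closed_vimage_permute_coords:
  assumes \<sigma>: "\<sigma> permutes {0..<n}" and "zariski_closed n Z"
  shows "zariski_closed n {x \<in> carrier_vec n. permute_coords \<sigma> x \<in> Z}"
proof -
  obtain P where P: "P \<subseteq> polys n" "Z = zero_locus n P"
    using assms(2) by (auto simp: zariski_closed_def)
  let ?Q = "Poly_Mapping.map_key (Poly_Mapping.map_key \<sigma>) ` P"
  have "?Q \<subseteq> polys n"
    using eval_poly_at_permute_coords(1)[OF \<sigma> _ zero_carrier_vec] P(1) by blast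
  moreover have "{x \<in> carrier_vec n. permute_coords \<sigma> x \<in> Z} = zero_locus n ?Q"
    using eval_poly_at_permute_coords(2)[OF \<sigma>] P by (auto simp: zero_locus_def subset_iff)
  ultimately show ?thesis
    unfolding zariski_closed_def by blast
qed

text \<open>For each closed \<open>Z\<close> containing \<open>S\<close>, the preimage of
  \<open>Z\<close> is again closed and contains \<open>S\<close> because \<open>S\<close> is stable;
  hence it contains \<open>x\<close>.\<close>

lemma zariski_closure_permute_coords:
  assumes \<sigma>: "\<sigma> permutes {0..<n}" and S: "S \<subseteq> carrier_vec n"
    and inv: "\<And>x. x \<in> S \<Longrightarrow> permute_coords \<sigma> x \<in> S"
    and x: "x \<in> zariski_closure n S"
  shows "permute_coords \<sigma> x \<in> zariski_closure n S"
  unfolding zariski_closure_def hull_def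
proof (intro InterI)
  fix Z assume "Z \<in> {Z. zariski_closed n Z \<and> S \<subseteq> Z}"
  then have "zariski_closed n {x \<in> carrier_vec n. permute_coords \<sigma> x \<in> Z}"
    "S \<subseteq> {x \<in> carrier_vec n. permute_coords \<sigma> x \<in> Z}"
    using zariski_closed_vimage_permute_coords[OF \<sigma>] S inv by auto
  then have "x \<in> {x \<in> carrier_vec n. permute_coords \<sigma> x \<in> Z}"
    using x unfolding zariski_closure_def hull_def by blast
  then show "permute_coords \<sigma> x \<in> Z" by simp
qed

section \<open>Rank under simultaneous row and column permutations\<close>

context vec_space
begin

text \<open>A dependency among the permuted vectors pulls back to one among the original vectors
  with the same coefficients: permuting coordinates is linear, and it is injective on
  \<open>U\<close>, so no two vectors of the set merge.\<close>

lemma lin_indpt_permute_coords: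
  assumes \<sigma>: "\<sigma> permutes {0..<n}" and U: "finite U" "U \<subseteq> carrier_vec n" "lin_indpt U"
  shows "lin_indpt (permute_coords \<sigma> ` U)"
proof
  let ?T = "permute_coords \<sigma> :: 'a vec \<Rightarrow> _"
  have inj: "inj_on ?T U"
    using permute_coords_inv[OF \<sigma>] U(2) by (metis inj_onI subsetD)
  have TU: "?T ` U \<subseteq> carrier_vec n"
    using U(2) by auto
  assume "lin_dep (?T ` U)"
  then obtain a w where a: "lincomb a (?T ` U) = 0\<^sub>v n" "w \<in> U" "a (?T w) \<noteq> 0"
    using finite_lin_dep[of "?T ` U"] TU U(1) by auto
  have "lincomb (a \<circ> ?T) U = 0\<^sub>v n"
  proof (rule eq_vecI)
    fix i assume "i < dim_vec (0\<^sub>v n :: 'a vec)"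
    then have i: "i < n" and j: "Hilbert_Choice.inv \<sigma> i < n"
      using permutes_in_image[OF permutes_inv[OF \<sigma>], of i] by auto
    have "lincomb (a \<circ> ?T) U $ i = (\<Sum>u\<in>U. a (?T u) * u $ i)"
      by (simp add: lincomb_index[OF i U(2)])
    also have "\<dots> = (\<Sum>u\<in>U. a (?T u) * ?T u $ Hilbert_Choice.inv \<sigma> i)"
      using U(2) j permutes_inverses(1)[OF \<sigma>]
      by (intro sum.cong) (auto simp: permute_coords_def subset_iff)
    also have "\<dots> = lincomb a (?T ` U) $ Hilbert_Choice.inv \<sigma> i"
      by (simp add: lincomb_index[OF j TU] sum.reindex[OF inj])
    finally show "lincomb (a \<circ> ?T) U $ i = 0\<^sub>v n $ i"
      using a(1) i j by simp
  qed (simp add: lincomb_dim U)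
  then have "lin_dep U"
    using a(2,3) by (intro lin_dep_crit[OF U(1) subset_refl, where a = "a \<circ> ?T" and v = w]) auto
  with U(3) show False by simp
qed

text \<open>Column \<open>j\<close> of \<open>B\<close> is column \<open>\<sigma> j\<close> of
  \<open>A\<close> with permuted coordinates. A largest independent set of columns of
  \<open>A\<close> is thus carried to equally many independent columns of \<open>B\<close>.\<close>

lemma rank_le_permute:
  assumes \<sigma>: "\<sigma> permutes {0..<n}" and A: "A \<in> carrier_mat n n" and B: "B \<in> carrier_mat n n"
    and BA: "\<And>i j. i < n \<Longrightarrow> j < n \<Longrightarrow> B $$ (i, j) = A $$ (\<sigma> i, \<sigma> j)"
  shows "rank A \<le> rank B"
proof -
  have \<sigma>_less: "\<sigma> i < n \<longleftrightarrow> i < n" for i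
    using permutes_in_image[OF \<sigma>, of i] by simp
  have "set (cols B) = (\<lambda>j. permute_coords \<sigma> (col A (\<sigma> j))) ` {0..<n}"
    using A B BA unfolding cols_def
    by (auto simp: permute_coords_def \<sigma>_less intro!: image_cong eq_vecI)
  also have "\<dots> = permute_coords \<sigma> ` col A ` \<sigma> ` {0..<n}"
    by (simp add: image_image)
  also have "\<dots> = permute_coords \<sigma> ` set (cols A)"
    using A by (simp add: permutes_image[OF \<sigma>] cols_def)
  finally have cols: "set (cols B) = permute_coords \<sigma> ` set (cols A)" .
  \<comment> \<open>\<open>U\<close> is a basis of the column space chosen among the columns, grown
    from the empty set; its cardinality is the rank of \<open>A\<close>.\<close>
  obtain U where U: "finite U" "maximal U (\<lambda>T. T \<subseteq> set (cols A) \<and> lin_indpt T)"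
    using maximal_exists_superset[of "set (cols A)" "\<lambda>T. T \<subseteq> set (cols A) \<and> lin_indpt T" "{}"]
    by (meson List.finite_set empty_subsetI finite_lin_indpt2 finite.emptyI empty_iff)
  then have "U \<subseteq> set (cols A)" "lin_indpt U"
    by (auto simp: maximal_def)
  moreover from this have U': "U \<subseteq> carrier_vec n"
    using A cols_dim by blast
  ultimately have "card (permute_coords \<sigma> ` U) \<le> rank B"
    using cols lin_indpt_permute_coords[OF \<sigma> U(1)] by (intro rank_ge_card_indpt[OF B]) auto
  moreover have "inj_on (permute_coords \<sigma>) U"
    using permute_coords_inv[OF \<sigma>] U' by (metis inj_onI subsetD)
  ultimately show ?thesis
    using rank_card_indpt[OF A U(2)] by (simp add: card_image)
qed

lemma rank_permute:
  assumes \<sigma>: "\<sigma> permutes {0..<n}" and A: "A \<in> carrier_mat n n" and B: "B \<in> carrier_mat n n"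
    and BA: "\<And>i j. i < n \<Longrightarrow> j < n \<Longrightarrow> B $$ (i, j) = A $$ (\<sigma> i, \<sigma> j)"
  shows "rank B = rank A"
proof (rule antisym)
  show "rank B \<le> rank A"
  proof (rule rank_le_permute[OF permutes_inv[OF \<sigma>] B A])
    fix i j assume "i < n" "j < n"
    then show "A $$ (i, j) = B $$ (Hilbert_Choice.inv \<sigma> i, Hilbert_Choice.inv \<sigma> j)"
      using permutes_in_image[OF permutes_inv[OF \<sigma>]]
      by (simp add: BA permutes_inverses(1)[OF \<sigma>])
  qed
qed (rule rank_le_permute[OF assms])

end

section \<open>Orientation-independent formulas\<close>

text \<open>Every arc of the graph is either listed in \<open>es\<close> or the reverse of a listed
  arc, never both. This turns edge sums into sums over \<open>parcs G\<close>, where the choice of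
  orientation has disappeared.\<close>

lemma sum_ordered_orientation:
  fixes h :: "'a \<Rightarrow> 'a \<Rightarrow> 'b::comm_monoid_add"
  assumes "ordered_orientation G es"
  shows "(\<Sum>l<length es. h (fst (es ! l)) (snd (es ! l)) + h (snd (es ! l)) (fst (es ! l))) =
    (\<Sum>(a, b)\<in>parcs G. h a b)"
proof -
  have es: "distinct es" "set es \<union> (set es)\<inverse> = parcs G" "set es \<inter> (set es)\<inverse> = {}"
    using assms by (auto simp: ordered_orientation_def)
  have "(\<Sum>l<length es. h (fst (es ! l)) (snd (es ! l)) + h (snd (es ! l)) (fst (es ! l))) =
      (\<Sum>e\<in>set es. h (fst e) (snd e) + h (snd e) (fst e))"
    by (rule sum.reindex_bij_betw[OF bij_betw_nth[OF es(1) refl refl]])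
  also have "\<dots> = (\<Sum>(a, b)\<in>set es. h a b) + (\<Sum>(a, b)\<in>set es. h b a)"
    by (simp add: sum.distrib case_prod_beta)
  also have "(\<Sum>(a, b)\<in>set es. h b a) = (\<Sum>(a, b)\<in>(set es)\<inverse>. h a b)"
    by (rule sum.reindex_bij_witness[where i = prod.swap and j = prod.swap]) auto
  finally show ?thesis
    unfolding es(2)[symmetric] using es(3) by (simp add: sum.union_disjoint)
qed

text \<open>An automorphism permutes the arcs, so this is a reindexing; surjectivity comes from the
  inverse permutation also preserving arcs.\<close>

lemma sum_parcs_graph_aut:
  assumes "pair_graph G" "\<sigma> \<in> graph_aut G"
  shows "(\<Sum>(a, b)\<in>parcs G. h (\<sigma> a) (\<sigma> b)) = (\<Sum>(a, b)\<in>parcs G. h a b)"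
proof -
  interpret pair_graph G by fact
  have \<sigma>: "\<sigma> permutes pverts G" "\<And>u v. u \<in> pverts G \<Longrightarrow> v \<in> pverts G \<Longrightarrow>
      (\<sigma> u, \<sigma> v) \<in> parcs G \<longleftrightarrow> (u, v) \<in> parcs G"
    using assms(2) by (auto simp: graph_aut_def)
  have "(Hilbert_Choice.inv \<sigma> a, Hilbert_Choice.inv \<sigma> b) \<in> parcs G" if "(a, b) \<in> parcs G" for a b
  proof -
    have "Hilbert_Choice.inv \<sigma> a \<in> pverts G" "Hilbert_Choice.inv \<sigma> b \<in> pverts G"
      using that in_arcsD1 in_arcsD2 permutes_in_image[OF permutes_inv[OF \<sigma>(1)]] by auto
    from \<sigma>(2)[OF this] that show ?thesis
      by (simp add: permutes_inverses[OF \<sigma>(1)])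
  qed
  then show ?thesis
    using \<sigma>(2) in_arcsD1 in_arcsD2
    by (intro sum.reindex_bij_witness
        [where j = "\<lambda>(a, b). (\<sigma> a, \<sigma> b)" and i = "\<lambda>(a, b). (Hilbert_Choice.inv \<sigma> a, Hilbert_Choice.inv \<sigma> b)"])
       (auto simp: permutes_inverses[OF \<sigma>(1)])
qed

lemma graph_aut_inv:
  assumes "\<sigma> \<in> graph_aut G"
  shows "Hilbert_Choice.inv \<sigma> \<in> graph_aut G"
proof -
  have \<sigma>: "\<sigma> permutes pverts G"
    using assms by (auto simp: graph_aut_def)
  have "(Hilbert_Choice.inv \<sigma> u, Hilbert_Choice.inv \<sigma> v) \<in> parcs G \<longleftrightarrow> (u, v) \<in> parcs G"
    if "u \<in> pverts G" "v \<in> pverts G" for u v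
  proof -
    have "Hilbert_Choice.inv \<sigma> u \<in> pverts G" "Hilbert_Choice.inv \<sigma> v \<in> pverts G"
      using that permutes_in_image[OF permutes_inv[OF \<sigma>]] by simp_all
    then have "(\<sigma> (Hilbert_Choice.inv \<sigma> u), \<sigma> (Hilbert_Choice.inv \<sigma> v)) \<in> parcs G \<longleftrightarrow>
        (Hilbert_Choice.inv \<sigma> u, Hilbert_Choice.inv \<sigma> v) \<in> parcs G"
      using assms unfolding graph_aut_def by blast
    then show ?thesis
      by (simp add: permutes_inverses(1)[OF \<sigma>])
  qed
  then show ?thesis
    using permutes_inv[OF \<sigma>] by (simp add: graph_aut_def)
qed

section \<open>Incidence matrix entries and the resulting sums over arcs\<close>

locale oriented_pair_graph =
  fixes G :: "nat pair_pre_digraph" and m :: nat and es :: "(nat \<times> nat) list"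
  assumes G: "pair_graph G" "pverts G = {0..<m}" and es: "ordered_orientation G es"
begin

abbreviation "A \<equiv> incidence_matrix m es"

lemma es_nth:
  assumes "l < length es"
  shows "fst (es ! l) < m" "snd (es ! l) < m" "fst (es ! l) \<noteq> snd (es ! l)"
proof -
  interpret pair_graph G by (fact G(1))
  have "es ! l \<in> parcs G"
    using es nth_mem[OF assms] by (auto simp: ordered_orientation_def)
  then show "fst (es ! l) < m" "snd (es ! l) < m" "fst (es ! l) \<noteq> snd (es ! l)"
    using arc_fst_in_verts arc_snd_in_verts pair_no_loops G(2) by auto
qed

lemma dim_A [simp]: "dim_row A = m" "dim_col A = length es"
  by (simp_all add: incidence_matrix_def)

lemma col_A:
  assumes "l < length es"
  shows "col A l = unit_vec m (fst (es ! l)) - unit_vec m (snd (es ! l))"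
  using assms unfolding incidence_matrix_def by (subst col_mat_of_cols) (auto simp: case_prod_beta)

lemma A_index:
  assumes "l < length es" "k < m"
  shows "A $$ (k, l) = of_bool (k = fst (es ! l)) - of_bool (k = snd (es ! l))"
proof -
  have "A $$ (k, l) = col A l $ k"
    using assms by simp
  then show ?thesis
    using assms es_nth[OF assms(1)] by (simp only: col_A) (auto simp: unit_vec_def)
qed

lemma laurent_mon_col:
  assumes "l < length es"
  shows "laurent_mon v (col A l) = v $ fst (es ! l) / v $ snd (es ! l)"
    and "laurent_mon v (- col A l) = v $ snd (es ! l) / v $ fst (es ! l)"
proof -
  have "- col A l = unit_vec m (snd (es ! l)) - unit_vec m (fst (es ! l))"
    by (auto simp: col_A[OF assms])
  then show "laurent_mon v (- col A l) = v $ snd (es ! l) / v $ fst (es ! l)"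
    using laurent_mon_edge es_nth[OF assms] by (simp add: divide_inverse)
  show "laurent_mon v (col A l) = v $ fst (es ! l) / v $ snd (es ! l)"
    using laurent_mon_edge es_nth[OF assms] by (simp add: col_A[OF assms] divide_inverse)
qed

text \<open>Reversing an edge changes the sign of both its incidence column and its entry of
  \<open>psi\<close>. The two end points of an edge therefore receive the same expression, evaluated
  at the two opposite arcs.\<close>

lemma A_psi_index:
  assumes "k < m"
  shows "(map_mat of_int A *\<^sub>v psi A v) $ k =
    (\<Sum>(a, b)\<in>parcs G. of_bool (k = a) * (1 / (2 * \<i>) * (v $ a / v $ b - v $ b / v $ a)))"
proof -
  have "(map_mat of_int A *\<^sub>v psi A v) $ k =
      (\<Sum>l<length es. of_int (A $$ (k, l)) * psi A v $ l)"
    using assms by (simp add: scalar_prod_def psi_def atLeast0LessThan)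
  also have "\<dots> = (\<Sum>(a, b)\<in>parcs G.
      of_bool (k = a) * (1 / (2 * \<i>) * (v $ a / v $ b - v $ b / v $ a)))"
    unfolding sum_ordered_orientation[OF es, symmetric]
    using assms by (intro sum.cong) (auto simp: A_index psi_def laurent_mon_col algebra_simps)
  finally show ?thesis .
qed

lemma jac_carrier [simp]: "jac A v \<in> carrier_mat m m"
  by (rule carrier_matI) (simp_all add: jac_def)

text \<open>This exhibits \<open>jac A v\<close> as a weighted graph Laplacian, with an edge weight
  symmetric in the two end points. The product of the two incidence entries splits into one term for
  each arc of the edge.\<close>

lemma jac_index:
  assumes "i < m" "j < m"
  shows "jac A v $$ (i, j) = (\<Sum>(a, b)\<in>parcs G.
    1 / 2 * (of_bool (i = a) * (of_bool (j = a) - of_bool (j = b)) *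
      (- \<i> * (v $ a / v $ b + v $ b / v $ a))))"
proof -
  define f where "f l = - \<i> * (laurent_mon v (col A l) + laurent_mon v (- col A l))" for l
  define E where "E = (map_mat of_int A :: complex mat)"
  have E: "E \<in> carrier_mat m (length es)"
    by (simp add: E_def carrier_matI)
  have E_index: "E $$ (k, l) = of_int (A $$ (k, l))" if "k < m" "l < length es" for k l
    using that by (simp add: E_def)
  have "jac A v = (1 / 2) \<cdot>\<^sub>m (E * mat_diag (length es) f * transpose_mat E)"
    unfolding jac_def E_def f_def by simp
  also have "E * mat_diag (length es) f = mat m (length es) (\<lambda>(i, l). E $$ (i, l) * f l)"
    by (rule mat_diag_mult_right[OF E])
  finally have "jac A v $$ (i, j) = (\<Sum>l<length es. 1 / 2 * (E $$ (i, l) * f l * E $$ (j, l)))"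
    using assms E by (simp add: scalar_prod_def atLeast0LessThan sum_distrib_left)
  also have "\<dots> = (\<Sum>(a, b)\<in>parcs G.
    1 / 2 * (of_bool (i = a) * (of_bool (j = a) - of_bool (j = b)) *
      (- \<i> * (v $ a / v $ b + v $ b / v $ a))))"
    unfolding sum_ordered_orientation[OF es, symmetric]
    using assms by (intro sum.cong) (auto simp: E_index f_def A_index laurent_mon_col algebra_simps)
  finally show ?thesis .
qed

section \<open>Equivariance of the arc sums under an automorphism\<close>

context
  fixes \<sigma> v w and c :: complex
  assumes \<sigma>: "\<sigma> \<in> graph_aut G" and c: "c \<noteq> 0"
    and w: "\<And>k. k < m \<Longrightarrow> w $ k = c * v $ \<sigma> k"
begin

lemma \<sigma>_permutes: "\<sigma> permutes {0..<m}"
  using \<sigma> G(2) by (auto simp: graph_aut_def)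

lemma \<sigma>_less [simp]: "\<sigma> k < m \<longleftrightarrow> k < m"
  using permutes_in_image[OF \<sigma>_permutes, of k] by simp

lemma \<sigma>_eq [simp]: "\<sigma> a = \<sigma> b \<longleftrightarrow> a = b"
  using permutes_inj[OF \<sigma>_permutes] by (auto dest: injD)

text \<open>The common factor \<open>c\<close> cancels, so rescaling to restore the last coordinate
  1 is invisible to all Laurent monomials of arcs.\<close>

lemma ratio:
  assumes "(a, b) \<in> parcs G"
  shows "w $ a / w $ b = v $ \<sigma> a / v $ \<sigma> b" "w $ b / w $ a = v $ \<sigma> b / v $ \<sigma> a"
proof -
  interpret pair_graph G by (fact G(1))
  have "a < m" "b < m"
    using in_arcsD1[OF assms] in_arcsD2[OF assms] G(2) by auto
  then show "w $ a / w $ b = v $ \<sigma> a / v $ \<sigma> b" "w $ b / w $ a = v $ \<sigma> b / v $ \<sigma> a"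
    using c by (simp_all add: w)
qed

lemma A_psi_graph_aut:
  "map_mat of_int A *\<^sub>v psi A w = permute_coords \<sigma> (map_mat of_int A *\<^sub>v psi A v)"
proof (rule eq_vecI)
  fix k assume "k < dim_vec (permute_coords \<sigma> (map_mat of_int A *\<^sub>v psi A v))"
  then have k: "k < m"
    by (simp add: permute_coords_def)
  \<comment> \<open>Writing \<open>k = a\<close> as \<open>\<sigma> k = \<sigma> a\<close> makes the
    summand a function of the image arc alone, ready for reindexing by \<sigma>.\<close>
  have "(map_mat of_int A *\<^sub>v psi A w) $ k = (\<Sum>(a, b)\<in>parcs G. of_bool (\<sigma> k = \<sigma> a) *
      (1 / (2 * \<i>) * (v $ \<sigma> a / v $ \<sigma> b - v $ \<sigma> b / v $ \<sigma> a)))"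
    unfolding A_psi_index[OF k] by (rule sum.cong) (auto simp: ratio)
  also have "\<dots> = (map_mat of_int A *\<^sub>v psi A v) $ \<sigma> k"
    using k A_psi_index[of "\<sigma> k" v]
    by (simp only: \<sigma>_less sum_parcs_graph_aut[OF G(1) \<sigma>, of "\<lambda>a b. of_bool (\<sigma> k = a) *
      (1 / (2 * \<i>) * (v $ a / v $ b - v $ b / v $ a))"])
  finally show "(map_mat of_int A *\<^sub>v psi A w) $ k =
      permute_coords \<sigma> (map_mat of_int A *\<^sub>v psi A v) $ k"
    using k by (simp add: permute_coords_def)
qed (simp add: permute_coords_def)

lemma jac_graph_aut:
  assumes "i < m" "j < m"
  shows "jac A w $$ (i, j) = jac A v $$ (\<sigma> i, \<sigma> j)"
proof -
  \<comment> \<open>The same rewriting, now for both the row and the column index.\<close>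
  have "jac A w $$ (i, j) = (\<Sum>(a, b)\<in>parcs G.
    1 / 2 * (of_bool (\<sigma> i = \<sigma> a) * (of_bool (\<sigma> j = \<sigma> a) - of_bool (\<sigma> j = \<sigma> b)) *
      (- \<i> * (v $ \<sigma> a / v $ \<sigma> b + v $ \<sigma> b / v $ \<sigma> a))))"
    unfolding jac_index[OF assms] by (rule sum.cong) (auto simp: ratio)
  also have "\<dots> = jac A v $$ (\<sigma> i, \<sigma> j)"
    using assms jac_index[of "\<sigma> i" "\<sigma> j" v]
    by (simp only: \<sigma>_less sum_parcs_graph_aut[OF G(1) \<sigma>, of "\<lambda>a b. 1 / 2 *
      (of_bool (\<sigma> i = a) * (of_bool (\<sigma> j = a) - of_bool (\<sigma> j = b)) *
      (- \<i> * (v $ a / v $ b + v $ b / v $ a)))"])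
  finally show ?thesis .
qed

lemma rank_jac_graph_aut: "vec_space.rank m (jac A w) = vec_space.rank m (jac A v)"
  by (rule vec_space.rank_permute[OF \<sigma>_permutes jac_carrier jac_carrier jac_graph_aut])

end

section \<open>Invariance of the discriminant\<close>

lemma lissajous_discriminant_graph_aut:
  assumes m: "m = d + 1" and \<sigma>: "\<sigma> \<in> graph_aut G" and \<omega>: "\<omega> \<in> lissajous_discriminant d A"
  shows "permute_coords \<sigma> \<omega> \<in> lissajous_discriminant d A"
  unfolding lissajous_discriminant_def
\<comment> \<open>It suffices to show that the set before taking the closure is stable under
  \<sigma>.\<close>
proof (rule zariski_closure_permute_coords[OF _ _ _ \<omega>[unfolded lissajous_discriminant_def]])
  show permutes: "\<sigma> permutes {0..<d + 1}"
    using \<sigma> G(2) m by (auto simp: graph_aut_def)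
  fix x assume "x \<in> {\<omega> \<in> carrier_vec (d + 1). \<exists>v \<in> complex_torus (d + 1).
    map_mat of_int A *\<^sub>v psi A v = \<omega> \<and> v $ d = 1 \<and> vec_space.rank (d + 1) (jac A v) < d}"
  then obtain v where x: "x \<in> carrier_vec m" and v: "v \<in> complex_torus m"
    "map_mat of_int A *\<^sub>v psi A v = x" "vec_space.rank m (jac A v) < d"
    by (auto simp: m)
  have \<sigma>_less: "\<sigma> k < m" if "k < m" for k
    using permutes_in_image[OF permutes, of k] that m by simp
  \<comment> \<open>Permuting \<open>v\<close> moves the entry 1 away from position \<open>d\<close>
    in general; this factor normalizes the last coordinate again. It is finite and nonzero because
    \<open>v\<close> lies in the torus.\<close>
  define c where "c = inverse (v $ \<sigma> d)"
  have nz: "v $ \<sigma> k \<noteq> 0" if "k < m" for k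
    using v(1) \<sigma>_less[OF that] by (simp add: complex_torus_def)
  have c: "c \<noteq> 0"
    using nz[of d] by (simp add: c_def m)
  define w where "w = vec m (\<lambda>k. c * v $ \<sigma> k)"
  have w: "w $ k = c * v $ \<sigma> k" if "k < m" for k
    using that by (simp add: w_def)
  have "w \<in> complex_torus m" "w $ d = 1"
    using c nz m by (auto simp: complex_torus_def w_def c_def)
  then show "permute_coords \<sigma> x \<in> {\<omega> \<in> carrier_vec (d + 1). \<exists>v \<in> complex_torus (d + 1).
    map_mat of_int A *\<^sub>v psi A v = \<omega> \<and> v $ d = 1 \<and> vec_space.rank (d + 1) (jac A v) < d}"
    using x v A_psi_graph_aut[OF \<sigma> c w] rank_jac_graph_aut[OF \<sigma> c w]
    unfolding m[symmetric] by auto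
qed blast

end

theorem proposition6p11:
  fixes G :: "nat pair_pre_digraph" and d m :: nat
    and es :: "(nat \<times> nat) list" and \<sigma> :: "nat \<Rightarrow> nat" and \<omega> :: "complex vec"
  assumes "pair_graph G" and "Digraph_Component.connected (with_proj G)"
    and "pverts G = {0..<m}" and "m = d + 1"
    and "ordered_orientation G es"
    and "\<sigma> \<in> graph_aut G"
    and "\<omega> \<in> carrier_vec (d + 1)"
  shows "\<omega> \<in> lissajous_discriminant d (incidence_matrix m es) \<longleftrightarrow>
         permute_coords \<sigma> \<omega> \<in> lissajous_discriminant d (incidence_matrix m es)"
proof -
  interpret oriented_pair_graph G m es
    by (rule oriented_pair_graph.intro) (fact assms)+
  have "\<sigma> permutes {0..<d + 1}"
    using assms(3,4,6) by (auto simp: graph_aut_def)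
  then have "permute_coords (Hilbert_Choice.inv \<sigma>) (permute_coords \<sigma> \<omega>) = \<omega>"
    using assms(7) by (rule permute_coords_inv)
  \<comment> \<open>The converse is the forward implication for the inverse automorphism, applied to
    the permuted point.\<close>
  then show ?thesis
    using lissajous_discriminant_graph_aut[OF assms(4,6)]
      lissajous_discriminant_graph_aut[OF assms(4) graph_aut_inv[OF assms(6)], of "permute_coords \<sigma> \<omega>"]
    by auto
qed

end
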